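(* Let $r \in \mathbb{Q}_{>0} \setminus \mathbb{N}$ be such that $\mathsf{n}(r) \neq 1$, and let $N$ be a nonempty subset of $\mathbb{N}_0$. Consider the Puiseux monoid $(S_{r,N},+) = \langle r^n \mid n \in N \rangle$, that is, the additive submonoid of $\mathbb{Q}_{\geq 0}$ generated by the powers $r^n$ with $n \in N$. Then $N$ is isomorphic to a numerical monoid if and only if $S_{r,N}$ is a semiring.
   Context: $\mathbb{N}$ denotes the positive integers and $\mathbb{N}_0$ the nonnegative integers. For $r \in \mathbb{Q}_{>0}$ write $r = \mathsf{n}(r)/\mathsf{d}(r)$ with $\mathsf{n}(r), \mathsf{d}(r)$ relatively prime positive integers. A Puiseux monoid is an additive submonoid of $\mathbb{Q}_{\geq 0}$. A numerical monoid is an additive submonoid of $\mathbb{N}_0$ whose complement in $\mathbb{N}_0$ is finite. Saying that the subset $N \subseteq \mathbb{N}_0$ is isomorphic to a numerical monoid means that $N$ is a submonoid of $(\mathbb{N}_0,+)$ (so it contains $0$ and is closed under addition) which, as a monoid under addition, is isomorphic to some numerical monoid. A (commutative) semiring is a nonempty set $S$ with operations $+$ and $\cdot$ such that $(S,+)$ is a commutative, cancellative, reduced monoid with identity $0$ (reduced means that the only invertible element is the identity), $(S,\cdot)$ is a commutative semigroup with identity $1$, $(a+b)\cdot c = a\cdot c + b\cdot c$ for all $a,b,c \in S$, and $0\cdot a=0$ for all $a \in S$. "$S_{r,N}$ is a semiring" refers to the standard addition and multiplication of $\mathbb{Q}$; that is, $S_{r,N}$ is closed under multiplication and contains $1$.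
   Formalization: The set N = {0} is excluded: there S_{r,N} = ℕ₀ is a semiring, but {0} is not isomorphic to a numerical monoid (these have finite complement, hence are infinite), so the claim fails in that case. *)

theory Defs
  imports Complex_Main "HOL-Algebra.Ring"
begin

definition additive_monoid :: "'a::comm_monoid_add set \<Rightarrow> 'a monoid" where
  "additive_monoid A = \<lparr>carrier = A, mult = (+), one = 0\<rparr>"

definition numerical_monoid :: "nat set \<Rightarrow> bool" where
  "numerical_monoid M \<longleftrightarrow> submonoid M (additive_monoid UNIV) \<and> finite (UNIV - M)"

(* A bijective homomorphism of monoids maps the identity to the identity, so \<cong> on the
   records below is isomorphism of monoids although hom only mentions the operation.
   The trivial submonoid {0} does not satisfy this predicate: numerical monoids are infinite. *)
definition isomorphic_to_numerical_monoid :: "nat set \<Rightarrow> bool" where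
  "isomorphic_to_numerical_monoid N \<longleftrightarrow>
     submonoid N (additive_monoid UNIV) \<and>
     (\<exists>M. numerical_monoid M \<and> additive_monoid N \<cong> additive_monoid M)"

definition puiseux_monoid :: "rat set \<Rightarrow> bool" where
  "puiseux_monoid S \<longleftrightarrow> submonoid S (additive_monoid {q. 0 \<le> q})"

(* For r \<ge> 0 all generators lie in {q. 0 \<le> q}, so this is the intersection of a
   nonempty family. *)
definition power_puiseux_monoid :: "rat \<Rightarrow> nat set \<Rightarrow> rat set" where
  "power_puiseux_monoid r N = puiseux_monoid hull {r ^ n | n. n \<in> N}"

(* Commutative semirings whose additive monoid is cancellative and reduced; HOL-Algebra's
   locale semiring requires neither of these, nor commutativity of the multiplication.
   The right-hand versions of l_distr and l_null follow by commutativity. *)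
locale cancellative_reduced_comm_semiring = abelian_monoid R + comm_monoid R
  for R (structure) +
  assumes a_cancel: "\<lbrakk>a \<in> carrier R; b \<in> carrier R; c \<in> carrier R; a \<oplus> c = b \<oplus> c\<rbrakk> \<Longrightarrow> a = b"
    and a_reduced: "Units (add_monoid R) = {\<zero>}"
    and l_distr: "\<lbrakk>a \<in> carrier R; b \<in> carrier R; c \<in> carrier R\<rbrakk>
                   \<Longrightarrow> (a \<oplus> b) \<otimes> c = a \<otimes> c \<oplus> b \<otimes> c"
    and l_null: "a \<in> carrier R \<Longrightarrow> \<zero> \<otimes> a = \<zero>"

definition rat_structure :: "rat set \<Rightarrow> rat ring" where
  "rat_structure S = \<lparr>carrier = S, mult = (*), one = 1, zero = 0, add = (+)\<rparr>"

end

theory Submission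
  imports Defs
begin

text \<open>
  Write \<open>r = a / b\<close> in lowest terms, so that \<open>a, b \<ge> 2\<close>. The key point is that
  \<open>r ^ m\<close> lies in the monoid generated by the \<open>r ^ n\<close>, \<open>n \<in> N\<close>, only if \<open>m \<in> N\<close>.
  Indeed, if \<open>r ^ m\<close> is a sum of other powers of \<open>r\<close>, each summand is at most \<open>r ^ m\<close>, so for
  \<open>r > 1\<close> only exponents \<open>n < m\<close> occur, whose powers have denominators dividing
  \<open>b ^ (m - 1)\<close>, while for \<open>r < 1\<close> only exponents \<open>n > m\<close> occur, whose
  powers have numerators divisible by \<open>a ^ (m + 1)\<close>; both are impossible for \<open>r ^ m\<close>. Hence the
  generated monoid contains \<open>1\<close> and is closed under products iff \<open>N\<close> is a submonoid of
  the naturals, and a nonzero submonoid becomes a numerical monoid after division by its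
  greatest common divisor.
\<close>

lemma submonoid_additive_monoid_iff:
  "submonoid N (additive_monoid A) \<longleftrightarrow> N \<subseteq> A \<and> 0 \<in> N \<and> (\<forall>x\<in>N. \<forall>y\<in>N. x + y \<in> N)"
  by (auto simp: submonoid_def additive_monoid_def)

lemma additive_monoid_iso_iff:
  "additive_monoid A \<cong> additive_monoid B \<longleftrightarrow>
    (\<exists>h. (\<forall>x\<in>A. \<forall>y\<in>A. h (x + y) = h x + h y) \<and> bij_betw h A B)"
  unfolding is_iso_def iso_def hom_def additive_monoid_def
  by (auto simp: bij_betw_def)

lemma puiseux_monoid_iff:
  "puiseux_monoid S \<longleftrightarrow> (\<forall>x\<in>S. 0 \<le> x) \<and> 0 \<in> S \<and> (\<forall>x\<in>S. \<forall>y\<in>S. x + y \<in> S)"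
  by (auto simp: puiseux_monoid_def submonoid_additive_monoid_iff)

section \<open>Submonoids of the natural numbers\<close>

lemma submonoid_nat_mult_closed:
  fixes N :: "nat set"
  assumes "submonoid N (additive_monoid UNIV)" and "x \<in> N"
  shows "k * x \<in> N"
  using assms by (induction k) (auto simp: submonoid_additive_monoid_iff)

text \<open>Divide \<open>n\<close> by \<open>u\<close> with quotient \<open>q\<close> and remainder
  \<open>s\<close>. If \<open>u * u \<le> n\<close> then \<open>s < u \<le> q\<close>, so
  \<open>n = (q - s) * u + s * Suc u\<close> uses nonnegative coefficients only. For
  \<open>u = 0\<close> the monoid contains 1.\<close>

lemma numerical_monoid_if_consecutive:
  assumes M: "submonoid M (additive_monoid UNIV)" and u: "u \<in> M" "Suc u \<in> M"
  shows "numerical_monoid M"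
proof -
  have "n \<in> M" if n: "u * u \<le> n" for n
  proof (cases "u = 0")
    case True
    then show ?thesis
      using submonoid_nat_mult_closed[OF M u(2), of n] by simp
  next
    case False
    let ?q = "n div u" and ?s = "n mod u"
    have "?s \<le> ?q"
      using False div_le_mono[OF n, of u] by (simp add: order.trans[OF mod_le_divisor])
    have "(?q - ?s) * u + ?s * Suc u = (?q - ?s + ?s) * u + ?s"
      by (simp add: algebra_simps)
    also have "\<dots> = n"
      using \<open>?s \<le> ?q\<close> by simp
    finally show ?thesis
      using M submonoid_nat_mult_closed[OF M u(1), of "?q - ?s"]
        submonoid_nat_mult_closed[OF M u(2), of ?s]
      by (metis submonoid_additive_monoid_iff)
  qed
  then have "UNIV - M \<subseteq> {..<u * u}"
    using not_less by auto
  then show ?thesis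
    using M finite_subset by (auto simp: numerical_monoid_def)
qed

text \<open>Take \<open>d\<close> to be the least positive difference of two elements of
  \<open>N\<close>. A nonzero remainder modulo \<open>d\<close> of an element of \<open>N\<close>
  would be a smaller such difference.\<close>

lemma submonoid_nat_consecutive_multiples:
  fixes N :: "nat set"
  assumes N: "submonoid N (additive_monoid UNIV)" and "N \<noteq> {0}"
  obtains d x where "0 < d" "x \<in> N" "x + d \<in> N" "\<forall>y\<in>N. d dvd y"
proof -
  let ?P = "\<lambda>d. 0 < d \<and> (\<exists>x\<in>N. x + d \<in> N)"
  have N0: "0 \<in> N" and add: "\<And>x y. x \<in> N \<Longrightarrow> y \<in> N \<Longrightarrow> x + y \<in> N"
    using N by (auto simp: submonoid_additive_monoid_iff)
  obtain y where "y \<in> N" "y \<noteq> 0"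
    using N0 \<open>N \<noteq> {0}\<close> by auto
  then have "?P y"
    using N0 by (auto intro!: bexI[of _ 0])
  then have P: "?P (LEAST d. ?P d)"
    by (rule LeastI)
  define d where "d = (LEAST d. ?P d)"
  from P obtain x where d: "0 < d" "x \<in> N" "x + d \<in> N"
    unfolding d_def by blast
  have "d dvd y" if "y \<in> N" for y
  proof (rule ccontr)
    assume "\<not> d dvd y"
    then have "0 < y mod d"
      by (simp add: mod_greater_zero_iff_not_dvd)
    \<comment> \<open>These two elements are chosen so that their difference is
      \<open>y - (y div d) * d = y mod d\<close>.\<close>
    moreover have "(y div d) * (x + d) \<in> N" "y + (y div d) * x \<in> N"
      using N d that by (auto intro!: add submonoid_nat_mult_closed)
    moreover have "(y div d) * (x + d) + y mod d = y + (y div d) * x"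
      by (simp add: algebra_simps)
    ultimately have "?P (y mod d)"
      by metis
    then have "d \<le> y mod d"
      unfolding d_def by (rule Least_le)
    then show False
      using mod_less_divisor[OF d(1), of y] by linarith
  qed
  with d show thesis
    using that by blast
qed

text \<open>Division by the \<open>d\<close> of the preceding lemma is additive on \<open>N\<close>
  and sends \<open>x\<close> and \<open>x + d\<close> to consecutive numbers. The submonoid
  \<open>{0}\<close> is excluded because numerical monoids are infinite.\<close>

lemma isomorphic_to_numerical_monoid_iff:
  assumes "N \<noteq> {0}"
  shows "isomorphic_to_numerical_monoid N \<longleftrightarrow> submonoid N (additive_monoid UNIV)"
proof
  assume N: "submonoid N (additive_monoid UNIV)"
  then obtain d x where d: "0 < d" "x \<in> N" "x + d \<in> N" and dvd: "\<forall>y\<in>N. d dvd y"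
    using assms submonoid_nat_consecutive_multiples by blast
  define M where "M = {n. d * n \<in> N}"
  obtain u where u: "x = d * u"
    using d dvd by blast
  have "submonoid M (additive_monoid UNIV)"
    using N by (auto simp: submonoid_additive_monoid_iff M_def algebra_simps)
  moreover have "u \<in> M" "Suc u \<in> M"
    using d u by (auto simp: M_def add.commute)
  ultimately have "numerical_monoid M"
    by (rule numerical_monoid_if_consecutive)
  moreover have "bij_betw (\<lambda>n. n div d) N M"
    by (rule bij_betw_byWitness[where f' = "\<lambda>n. d * n"])
      (use d dvd in \<open>auto simp: M_def\<close>)
  then have "additive_monoid N \<cong> additive_monoid M"
    using dvd unfolding additive_monoid_iso_iff by (metis div_plus_div_distrib_dvd_left)
  ultimately show "isomorphic_to_numerical_monoid N"
    using N by (auto simp: isomorphic_to_numerical_monoid_def)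
qed (simp add: isomorphic_to_numerical_monoid_def)

section \<open>The generated Puiseux monoid and its multiplication\<close>

lemma puiseux_monoid_power_puiseux_monoid:
  assumes "0 \<le> r"
  shows "puiseux_monoid (power_puiseux_monoid r N)"
proof -
  have "puiseux_monoid {q. 0 \<le> q}"
    by (simp add: puiseux_monoid_iff)
  moreover have "{r ^ n |n. n \<in> N} \<subseteq> {q. 0 \<le> q}"
    using assms by auto
  ultimately have "power_puiseux_monoid r N \<subseteq> {q. 0 \<le> q}"
    unfolding power_puiseux_monoid_def by (intro hull_minimal)
  then show ?thesis
    unfolding puiseux_monoid_iff power_puiseux_monoid_def hull_def by auto
qed

lemma power_in_power_puiseux_monoid:
  "n \<in> N \<Longrightarrow> r ^ n \<in> power_puiseux_monoid r N"
  unfolding power_puiseux_monoid_def by (rule hull_inc) blast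

lemma power_puiseux_monoid_subset:
  assumes "puiseux_monoid T" and "\<And>n. n \<in> N \<Longrightarrow> r ^ n \<in> T"
  shows "power_puiseux_monoid r N \<subseteq> T"
  unfolding power_puiseux_monoid_def using assms by (intro hull_minimal) auto

lemma power_puiseux_monoid_mult_closed:
  assumes r: "0 \<le> r" and N: "submonoid N (additive_monoid UNIV)"
    and x: "x \<in> power_puiseux_monoid r N" and y: "y \<in> power_puiseux_monoid r N"
  shows "x * y \<in> power_puiseux_monoid r N"
proof -
  let ?S = "power_puiseux_monoid r N"
  have S: "puiseux_monoid ?S"
    using r by (rule puiseux_monoid_power_puiseux_monoid)
  \<comment> \<open>By this, closure under multiplication by a fixed \<open>c\<close> only has to be
    checked on generators. It is applied twice: first with \<open>c\<close> a power of
    \<open>r\<close>, then with \<open>c = y\<close>.\<close>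
  have transport: "puiseux_monoid {z \<in> ?S. z * c \<in> ?S}" for c
    using S by (auto simp: puiseux_monoid_iff distrib_right)
  have gen: "z * r ^ n \<in> ?S" if "n \<in> N" "z \<in> ?S" for z n
  proof -
    have "?S \<subseteq> {z \<in> ?S. z * r ^ n \<in> ?S}"
    proof (rule power_puiseux_monoid_subset[OF transport])
      fix m assume "m \<in> N"
      then show "r ^ m \<in> {z \<in> ?S. z * r ^ n \<in> ?S}"
        using N \<open>n \<in> N\<close> power_in_power_puiseux_monoid[of "m + n" N r]
        by (auto simp: power_in_power_puiseux_monoid submonoid_additive_monoid_iff power_add)
    qed
    with that show ?thesis
      by auto
  qed
  have "?S \<subseteq> {z \<in> ?S. z * y \<in> ?S}"
    by (rule power_puiseux_monoid_subset[OF transport])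
      (use gen[OF _ y] in \<open>auto simp: power_in_power_puiseux_monoid mult.commute\<close>)
  with x show ?thesis
    by auto
qed

lemma semiring_rat_structure_iff:
  assumes S: "puiseux_monoid S"
  shows "cancellative_reduced_comm_semiring (rat_structure S) \<longleftrightarrow>
    1 \<in> S \<and> (\<forall>x\<in>S. \<forall>y\<in>S. x * y \<in> S)"
proof
  assume "cancellative_reduced_comm_semiring (rat_structure S)"
  then interpret cancellative_reduced_comm_semiring "rat_structure S" .
  show "1 \<in> S \<and> (\<forall>x\<in>S. \<forall>y\<in>S. x * y \<in> S)"
    using one_closed m_closed by (simp add: rat_structure_def)
next
  assume S1: "1 \<in> S \<and> (\<forall>x\<in>S. \<forall>y\<in>S. x * y \<in> S)"
  have S0: "\<And>x. x \<in> S \<Longrightarrow> 0 \<le> x" "0 \<in> S" "\<And>x y. x \<in> S \<Longrightarrow> y \<in> S \<Longrightarrow> x + y \<in> S"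
    using S by (auto simp: puiseux_monoid_iff)
  have "Units (add_monoid (rat_structure S)) = {\<zero>\<^bsub>rat_structure S\<^esub>}"
    using S0 by (force simp: Units_def rat_structure_def add_nonneg_eq_0_iff)
  moreover have "abelian_monoid (rat_structure S)"
    by (rule abelian_monoidI) (use S0 in \<open>auto simp: rat_structure_def\<close>)
  moreover have "comm_monoid (rat_structure S)"
    by (rule comm_monoidI) (use S1 in \<open>auto simp: rat_structure_def\<close>)
  ultimately show "cancellative_reduced_comm_semiring (rat_structure S)"
    unfolding cancellative_reduced_comm_semiring_def
      cancellative_reduced_comm_semiring_axioms_def
    by (auto simp: rat_structure_def algebra_simps)
qed

section \<open>Which powers of \<open>r\<close> lie in the generated monoid\<close>

lemma power_notin_power_puiseux_monoid_gt_1: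
  fixes a b :: int
  assumes r: "r = of_int a / of_int b" "1 < r" and b: "1 < b" and cop: "coprime a b"
    and m: "m \<notin> N"
  shows "r ^ m \<notin> power_puiseux_monoid r N"
proof -
  define T where "T = {x. 0 \<le> x \<and> (r ^ m < x \<or> (\<exists>k. x * of_int b ^ m = of_int (b * k)))}"
  have T: "puiseux_monoid T"
    unfolding puiseux_monoid_iff
  proof (intro conjI ballI)
    show "0 \<in> T"
      by (auto simp: T_def intro: exI[of _ 0])
    fix x y assume xy: "x \<in> T" "y \<in> T"
    show "x + y \<in> T"
    proof (cases "r ^ m < x \<or> r ^ m < y")
      case True
      with xy show ?thesis by (auto simp: T_def)
    next
      case False
      with xy obtain k l where "x * of_int b ^ m = of_int (b * k)" "y * of_int b ^ m = of_int (b * l)"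
        by (auto simp: T_def)
      then have "(x + y) * of_int b ^ m = of_int (b * (k + l))"
        by (simp add: algebra_simps)
      moreover have "0 \<le> x + y"
        using xy by (auto simp: T_def)
      ultimately show ?thesis unfolding T_def by blast
    qed
  qed (simp add: T_def)
  have "r ^ n \<in> T" if "n \<in> N" for n
  proof (cases "m < n")
    case True
    then show ?thesis
      using r(2) power_strict_increasing[of m n r] by (simp add: T_def)
  next
    case False
    \<comment> \<open>\<open>n = m\<close> is ruled out by \<open>m \<notin> N\<close>; the
      \<open>Suc\<close> supplies the required factor \<open>b\<close>.\<close>
    with m that obtain j where j: "m = Suc (n + j)"
      by (metis less_imp_Suc_add nat_neq_iff)
    have "r ^ n * of_int b ^ m = of_int (b * (a ^ n * b ^ j))"
      using b by (simp add: r(1) j power_add power_divide)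
    moreover have "0 \<le> r ^ n"
      using r(2) by simp
    ultimately show ?thesis unfolding T_def by blast
  qed
  with T have "power_puiseux_monoid r N \<subseteq> T"
    by (rule power_puiseux_monoid_subset)
  moreover have "r ^ m \<notin> T"
  proof
    assume "r ^ m \<in> T"
    then obtain k where "r ^ m * of_int b ^ m = of_int (b * k)"
      by (auto simp: T_def)
    moreover have "r ^ m * of_int b ^ m = of_int (a ^ m)"
      using b by (simp add: r(1) power_divide)
    ultimately have "a ^ m = b * k"
      by (metis of_int_eq_iff)
    then have "b dvd a ^ m"
      by simp
    moreover have "coprime (a ^ m) b"
      using cop by simp
    ultimately have "is_unit b"
      by (meson coprime_common_divisor dvd_refl)
    with b show False by simp
  qed
  ultimately show ?thesis by blast
qed

lemma power_notin_power_puiseux_monoid_lt_1: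
  fixes a b :: int
  assumes r: "r = of_int a / of_int b" "r < 1" and a: "1 < a" and b: "0 < b"
    and cop: "coprime a b" and m: "m \<notin> N"
  shows "r ^ m \<notin> power_puiseux_monoid r N"
proof -
  have r0: "0 < r"
    using r(1) a b by simp
  \<comment> \<open>The exponents \<open>n > m\<close> are unbounded, so no single power of
    \<open>b\<close> clears all denominators and \<open>K\<close> is existential. Up to powers of
    \<open>b\<close>, the condition says that \<open>a ^ Suc m\<close> divides the
    numerator.\<close>
  define T where
    "T = {x. 0 \<le> x \<and> (r ^ m < x \<or> (\<exists>K k. x * of_int b ^ K = of_int (a ^ Suc m * k)))}"
  have T: "puiseux_monoid T"
    unfolding puiseux_monoid_iff
  proof (intro conjI ballI)
    show "0 \<in> T"
      by (auto simp: T_def intro: exI[of _ 0])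
    fix x y assume xy: "x \<in> T" "y \<in> T"
    show "x + y \<in> T"
    proof (cases "r ^ m < x \<or> r ^ m < y")
      case True
      with xy show ?thesis by (auto simp: T_def)
    next
      case False
      with xy obtain K k L l where
        kl: "x * of_int b ^ K = of_int (a ^ Suc m * k)" "y * of_int b ^ L = of_int (a ^ Suc m * l)"
        unfolding T_def by blast
      have "(x + y) * of_int b ^ (K + L) =
          x * of_int b ^ K * of_int b ^ L + y * of_int b ^ L * of_int b ^ K"
        by (simp add: algebra_simps power_add)
      also have "\<dots> = of_int (a ^ Suc m * (k * b ^ L + l * b ^ K))"
        unfolding kl by (simp add: algebra_simps)
      finally have "\<exists>M j. (x + y) * of_int b ^ M = of_int (a ^ Suc m * j)"
        by blast
      moreover have "0 \<le> x + y"
        using xy by (auto simp: T_def)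
      ultimately show ?thesis unfolding T_def by blast
    qed
  qed (simp add: T_def)
  have "r ^ n \<in> T" if "n \<in> N" for n
  proof (cases "n < m")
    case True
    then show ?thesis
      using r(2) r0 power_strict_decreasing[of n m r] by (simp add: T_def)
  next
    case False
    with m that obtain j where j: "n = Suc (m + j)"
      by (metis less_imp_Suc_add nat_neq_iff)
    have "r ^ n * of_int b ^ n = of_int (a ^ Suc m * a ^ j)"
      using b by (simp add: r(1) j power_add power_divide)
    moreover have "0 \<le> r ^ n"
      using r0 by simp
    ultimately show ?thesis unfolding T_def by blast
  qed
  with T have "power_puiseux_monoid r N \<subseteq> T"
    by (rule power_puiseux_monoid_subset)
  moreover have "r ^ m \<notin> T"
  proof
    assume "r ^ m \<in> T"
    then obtain K k where k: "r ^ m * of_int b ^ K = of_int (a ^ Suc m * k)"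
      unfolding T_def by blast
    \<comment> \<open>Scaling by a further \<open>b ^ m\<close> clears the denominator of
      \<open>r ^ m\<close>; cancelling \<open>a ^ m\<close> then leaves one factor \<open>a\<close>
      dividing \<open>b ^ K\<close>.\<close>
    have "rat_of_int (a ^ m * b ^ K) = r ^ m * of_int b ^ K * of_int b ^ m"
      using b by (simp add: r(1) power_divide)
    also have "\<dots> = of_int (a ^ m * (a * k * b ^ m))"
      unfolding k by simp
    finally have "a ^ m * b ^ K = a ^ m * (a * k * b ^ m)"
      by (simp only: of_int_eq_iff)
    then have "b ^ K = a * k * b ^ m"
      using a by simp
    then have "a dvd b ^ K"
      by simp
    moreover have "coprime a (b ^ K)"
      using cop by simp
    ultimately have "is_unit a"
      by (meson coprime_common_divisor dvd_refl)
    with a show False by simp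
  qed
  ultimately show ?thesis by blast
qed

text \<open>Non-integrality of \<open>r\<close> gives \<open>1 < b\<close> for the case
  \<open>1 < r\<close>, and the numerator condition gives \<open>1 < a\<close> for the case
  \<open>r < 1\<close>.\<close>

lemma power_in_power_puiseux_monoid_iff:
  assumes "0 < r" and "r \<notin> \<nat>" and "fst (quotient_of r) \<noteq> 1"
  shows "r ^ m \<in> power_puiseux_monoid r N \<longleftrightarrow> m \<in> N"
proof -
  obtain a b where q: "quotient_of r = (a, b)"
    by fastforce
  have r: "r = of_int a / of_int b" and b: "0 < b" and cop: "coprime a b"
    using q quotient_of_div quotient_of_denom_pos quotient_of_coprime by blast+
  have "0 < a"
    using r b \<open>0 < r\<close> by (simp add: zero_less_divide_iff)
  with assms(3) q have a: "1 < a"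
    by simp
  have "b \<noteq> 1"
  proof
    assume "b = 1"
    with r a have "r = of_nat (nat a)"
      by simp
    with assms(2) show False by simp
  qed
  with b have b1: "1 < b"
    by simp
  have "r \<noteq> 1"
    using assms(2) by auto
  then show ?thesis
    using power_notin_power_puiseux_monoid_gt_1[OF r _ b1 cop]
      power_notin_power_puiseux_monoid_lt_1[OF r _ a b cop]
      power_in_power_puiseux_monoid by (metis linorder_neqE)
qed

theorem proposition5p1:
  fixes r :: rat and N :: "nat set"
  assumes "0 < r" and "r \<notin> \<nat>"
    and "fst (quotient_of r) \<noteq> 1"
    and "N \<noteq> {}" and "N \<noteq> {0}"
  shows "isomorphic_to_numerical_monoid N \<longleftrightarrow>
         cancellative_reduced_comm_semiring (rat_structure (power_puiseux_monoid r N))"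
proof -
  let ?S = "power_puiseux_monoid r N"
  have mem: "r ^ m \<in> ?S \<longleftrightarrow> m \<in> N" for m
    using assms(1-3) by (rule power_in_power_puiseux_monoid_iff)
  \<comment> \<open>Since \<open>r ^ 0 = 1\<close> and exponents add under multiplication,
    \<open>mem\<close> carries the semiring conditions on powers of \<open>r\<close> back to
    \<open>N\<close>.\<close>
  have "submonoid N (additive_monoid UNIV) \<longleftrightarrow> 1 \<in> ?S \<and> (\<forall>x\<in>?S. \<forall>y\<in>?S. x * y \<in> ?S)"
  proof
    assume N: "submonoid N (additive_monoid UNIV)"
    then show "1 \<in> ?S \<and> (\<forall>x\<in>?S. \<forall>y\<in>?S. x * y \<in> ?S)"
      using mem[of 0] power_puiseux_monoid_mult_closed[OF _ N] assms(1)
      by (simp add: submonoid_additive_monoid_iff)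
  next
    assume "1 \<in> ?S \<and> (\<forall>x\<in>?S. \<forall>y\<in>?S. x * y \<in> ?S)"
    then show "submonoid N (additive_monoid UNIV)"
      using mem[of 0] by (auto simp: submonoid_additive_monoid_iff mem[symmetric] power_add)
  qed
  then show ?thesis
    using assms(1,5) puiseux_monoid_power_puiseux_monoid[of r N]
    by (simp add: isomorphic_to_numerical_monoid_iff semiring_rat_structure_iff)
qed

end
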